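(* Let $(V,E,<)$ be a nonempty wellordered connected graph with algorithmic breadth-first traversal $\prec$, let $p^\circ$ be the least neighbor function of $\prec$, and let $E^\star\subseteq E$ be the (symmetric) edge relation connecting each non-minimal $v$ to $p^\circ(v)$. Then the algorithmic breadth-first traversals $\prec$ and $\prec^\star$ of $(V,E,<)$ and $(V,E^\star,<)$ respectively are identical.
   Context: A wellordered connected graph $(V,E,<)$ is a connected undirected graph $(V,E)$ (possibly infinite) together with a wellordering $<$ of $V$. Deterministic breadth-first search on $(V,E,<)$: define sets $B_\alpha$ and sequences $Q_\alpha$ (regarded both as sequences and as sets) by transfinite recursion, where $q_\alpha$ denotes the first element of $Q_\alpha\setminus B_\alpha$ whenever that is nonempty. $B_0=\emptyset$ and $Q_0=(v_0)$, where $v_0$ is the $<$-least element of $V$. If $Q_\alpha\setminus B_\alpha\neq\emptyset$, then $B_{\alpha+1}=B_\alpha\cup\{q_\alpha\}$ and $Q_{\alpha+1}$ is obtained from $Q_\alpha$ by appending at the end, in $<$-order, all neighbors of $q_\alpha$ not in $Q_\alpha$; otherwise $B_{\alpha+1}=B_\alpha$ and $Q_{\alpha+1}=Q_\alpha$. At limit $\alpha$, $B_\alpha=\bigcup_{\beta<\alpha}B_\beta$ and $Q_\alpha=\bigcup_{\beta<\alpha}Q_\beta$ (each later sequence end-extends the earlier ones). The closure ordinal $\Gamma$ is the least ordinal with $B_\Gamma=B_{\Gamma+1}$; one has $B_\Gamma=V$, so $\alpha\mapsto q_\alpha$ is a bijection $\Gamma\to V$. The algorithmic breadth-first traversal is the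 wellordering $\prec$ of $V$ with $q_\alpha\prec q_\beta$ iff $\alpha<\beta$. The least neighbor function $p^\circ$ takes each vertex other than the $\prec$-minimum to its $\prec$-least $E$-neighbor. The graph $(V,E^\star)$ is a spanning tree of $(V,E)$, hence connected. *)

theory Defs
  imports Main
begin

text \<open>
  Ordinals: the type \<open>'a ordinal\<close> is an initial segment of the ordinals, namely the least ordinal
  of the cardinality of the type \<open>(nat + 'a) set\<close>. It is an infinite limit ordinal
  (\<open>ordinal_no_max\<close>) whose cardinality exceeds that of \<open>'a\<close> (\<open>ordinal_not_inj\<close>), so
  breadth-first search on a graph with vertices in \<open>'a\<close> terminates within it
  (\<open>bfs_closure_exists\<close>).
\<close>

typedef 'a ordinal = "UNIV :: (nat + 'a) set set"
  by simp

instantiation ordinal :: (type) wellorder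
begin

definition less_eq_ordinal :: "'a ordinal \<Rightarrow> 'a ordinal \<Rightarrow> bool" where
  "\<alpha> \<le> \<beta> \<longleftrightarrow> (Rep_ordinal \<alpha>, Rep_ordinal \<beta>) \<in> card_of UNIV"

definition less_ordinal :: "'a ordinal \<Rightarrow> 'a ordinal \<Rightarrow> bool" where
  "(\<alpha> :: 'a ordinal) < \<beta> \<longleftrightarrow> \<alpha> \<le> \<beta> \<and> \<alpha> \<noteq> \<beta>"

instance
proof -
  let ?r = "card_of (UNIV :: (nat + 'a) set set)"
  have wo: "well_order_on UNIV ?r"
    by (rule card_of_well_order_on)
  then have refl: "refl ?r" and trans: "trans ?r" and antisym: "antisym ?r"
    and total: "total ?r" and wf: "wf (?r - Id)"
    by (auto simp: well_order_on_def linear_order_on_def partial_order_on_def preorder_on_def)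
  show "OFCLASS('a ordinal, wellorder_class)"
  proof
    fix x y z :: "'a ordinal"
    show refl': "x \<le> x"
      using refl by (simp add: less_eq_ordinal_def refl_on_def)
    show "x \<le> y \<Longrightarrow> y \<le> z \<Longrightarrow> x \<le> z"
      using trans unfolding less_eq_ordinal_def by (meson transD)
    show antisym': "x \<le> y \<Longrightarrow> y \<le> x \<Longrightarrow> x = y"
      using antisym unfolding less_eq_ordinal_def by (metis Rep_ordinal_inject antisymD)
    show "x < y \<longleftrightarrow> x \<le> y \<and> \<not> y \<le> x"
      using refl' antisym' by (auto simp: less_ordinal_def)
    show "x \<le> y \<or> y \<le> x"
      using total refl unfolding less_eq_ordinal_def total_on_def refl_on_def by (metis UNIV_I)
  next
    fix P :: "'a ordinal \<Rightarrow> bool" and a :: "'a ordinal"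
    assume step: "\<And>x. (\<And>y. y < x \<Longrightarrow> P y) \<Longrightarrow> P x"
    have "wf (inv_image (?r - Id) Rep_ordinal)"
      using wf by (rule wf_inv_image)
    then show "P a"
    proof (induction a rule: wf_induct_rule)
      case (less x)
      show ?case
        by (rule step, rule less)
          (auto simp: less_ordinal_def less_eq_ordinal_def Rep_ordinal_inject)
    qed
  qed
qed

end

lemma ordinal_no_max: "\<exists>\<beta>. \<alpha> < (\<beta> :: 'a ordinal)"
proof -
  let ?r = "card_of (UNIV :: (nat + 'a) set set)"
  have "infinite (UNIV :: (nat + 'a) set set)"
    by (simp add: Finite_Set.finite_set finite_Plus_UNIV_iff)
  then obtain b where "Rep_ordinal \<alpha> \<noteq> b" "(Rep_ordinal \<alpha>, b) \<in> ?r"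
    using infinite_Card_order_limit[of ?r "Rep_ordinal \<alpha>"]
    by (auto simp: Field_card_of card_of_card_order_on)
  then show ?thesis
    by (intro exI[of _ "Abs_ordinal b"])
      (auto simp: less_ordinal_def less_eq_ordinal_def Abs_ordinal_inverse)
qed

lemma ordinal_not_inj: "\<not> inj (f :: 'a ordinal \<Rightarrow> 'a)"
proof
  assume "inj f"
  then have "inj (Inr \<circ> f \<circ> Abs_ordinal :: (nat + 'a) set \<Rightarrow> nat + 'a)"
    by (intro inj_compose) (simp_all add: inj_def Abs_ordinal_inject)
  moreover have "\<not> inj g" for g :: "(nat + 'a) set \<Rightarrow> nat + 'a"
    using Cantors_theorem[of "UNIV :: (nat + 'a) set"] inj_imp_surj_inv[of g] by auto
  ultimately show False
    by blast
qed

definition ord_zero :: "'a ordinal" where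
  "ord_zero = (LEAST \<alpha>. True)"

definition ord_succ :: "'a ordinal \<Rightarrow> 'a ordinal" where
  "ord_succ \<alpha> = (LEAST \<beta>. \<alpha> < \<beta>)"

definition ord_limit :: "'a ordinal \<Rightarrow> bool" where
  "ord_limit \<alpha> \<longleftrightarrow> \<alpha> \<noteq> ord_zero \<and> (\<nexists>\<beta>. \<alpha> = ord_succ \<beta>)"

lemma less_ord_succ [simp]: "\<alpha> < ord_succ \<alpha>"
  unfolding ord_succ_def using ordinal_no_max by (rule LeastI_ex)

lemma ord_succ_le: "\<alpha> < \<beta> \<Longrightarrow> ord_succ \<alpha> \<le> \<beta>"
  unfolding ord_succ_def by (rule Least_le)

lemma ord_succ_inject [simp]: "ord_succ \<alpha> = ord_succ \<beta> \<longleftrightarrow> \<alpha> = \<beta>"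
  by (metis less_ord_succ leD linorder_less_linear ord_succ_le)

lemma ord_zero_le [simp]: "ord_zero \<le> \<alpha>"
  unfolding ord_zero_def by (rule Least_le) simp

lemma ord_succ_neq_zero [simp]: "ord_succ \<alpha> \<noteq> ord_zero"
  by (metis less_ord_succ leD ord_zero_le)

text \<open>
  Wellorderings are reflexive relations, as in \<^const>\<open>well_order_on\<close>, and
  \<^term>\<open>wo_rel.minim r A\<close> is the \<open>r\<close>-least element of \<open>A\<close>. Edge relations are symmetric sets of
  ordered pairs. Loops are not excluded.
\<close>

definition wellordered_connected_graph :: "'v set \<Rightarrow> 'v rel \<Rightarrow> 'v rel \<Rightarrow> bool" where
  "wellordered_connected_graph V E lt \<longleftrightarrow>
     E \<subseteq> V \<times> V \<and> sym E \<and> (\<forall>u\<in>V. \<forall>v\<in>V. (u, v) \<in> E\<^sup>*) \<and> well_order_on V lt"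

text \<open>
  The sequences \<open>Q\<close> have no repetitions, so they are represented by the (reflexive) wellorderings of
  their sets of entries: the set of entries of \<open>Q\<close> is \<^term>\<open>Field Q\<close>, an initial segment is a
  subrelation, and the union of a chain of end-extensions is the union of the relations.
\<close>

definition append_in_order :: "'v rel \<Rightarrow> 'v rel \<Rightarrow> 'v set \<Rightarrow> 'v rel" where
  "append_in_order lt Q N = Q \<union> Field Q \<times> N \<union> (lt \<inter> N \<times> N)"

definition first_unvisited :: "'v set \<Rightarrow> 'v rel \<Rightarrow> 'v" where
  "first_unvisited B Q = wo_rel.minim Q (Field Q - B)"

definition bfs_step :: "'v rel \<Rightarrow> 'v rel \<Rightarrow> 'v set \<times> 'v rel \<Rightarrow> 'v set \<times> 'v rel" where
  "bfs_step E lt = (\<lambda>(B, Q).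
     if Field Q - B \<noteq> {} then
       let q = first_unvisited B Q
       in (insert q B, append_in_order lt Q (E `` {q} - Field Q))
     else (B, Q))"

function bfs :: "'v set \<Rightarrow> 'v rel \<Rightarrow> 'v rel \<Rightarrow> 'v ordinal \<Rightarrow> 'v set \<times> 'v rel" where
  "bfs V E lt \<alpha> =
     (if \<alpha> = ord_zero then ({}, {(wo_rel.minim lt V, wo_rel.minim lt V)})
      else if \<exists>\<beta>. \<alpha> = ord_succ \<beta> then bfs_step E lt (bfs V E lt (THE \<beta>. \<alpha> = ord_succ \<beta>))
      else (\<Union>\<beta>\<in>{..<\<alpha>}. fst (bfs V E lt \<beta>), \<Union>\<beta>\<in>{..<\<alpha>}. snd (bfs V E lt \<beta>)))"
  by auto
termination
proof (relation "inv_image {(\<alpha>, \<beta>). \<alpha> < \<beta>} (\<lambda>(V, E, lt, \<alpha>). \<alpha>)")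
  show "wf (inv_image {(\<alpha>, \<beta> :: 'v ordinal). \<alpha> < \<beta>}
      (\<lambda>(V :: 'v set, E :: 'v rel, lt :: 'v rel, \<alpha>). \<alpha>))"
    by (intro wf_inv_image wf)
qed auto

declare bfs.simps [simp del]

lemma bfs_zero:
  "bfs V E lt ord_zero = ({}, {(wo_rel.minim lt V, wo_rel.minim lt V)})"
  by (simp add: bfs.simps)

lemma bfs_succ: "bfs V E lt (ord_succ \<alpha>) = bfs_step E lt (bfs V E lt \<alpha>)"
  by (subst bfs.simps) simp

lemma bfs_limit:
  "ord_limit \<alpha> \<Longrightarrow>
    bfs V E lt \<alpha> = (\<Union>\<beta>\<in>{..<\<alpha>}. fst (bfs V E lt \<beta>), \<Union>\<beta>\<in>{..<\<alpha>}. snd (bfs V E lt \<beta>))"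
  by (subst bfs.simps) (simp add: ord_limit_def)

definition bfs_B :: "'v set \<Rightarrow> 'v rel \<Rightarrow> 'v rel \<Rightarrow> 'v ordinal \<Rightarrow> 'v set" where
  "bfs_B V E lt \<alpha> = fst (bfs V E lt \<alpha>)"

definition bfs_Q :: "'v set \<Rightarrow> 'v rel \<Rightarrow> 'v rel \<Rightarrow> 'v ordinal \<Rightarrow> 'v rel" where
  "bfs_Q V E lt \<alpha> = snd (bfs V E lt \<alpha>)"

definition bfs_q :: "'v set \<Rightarrow> 'v rel \<Rightarrow> 'v rel \<Rightarrow> 'v ordinal \<Rightarrow> 'v" where
  "bfs_q V E lt \<alpha> = first_unvisited (bfs_B V E lt \<alpha>) (bfs_Q V E lt \<alpha>)"

definition bfs_closure :: "'v set \<Rightarrow> 'v rel \<Rightarrow> 'v rel \<Rightarrow> 'v ordinal" where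
  "bfs_closure V E lt = (LEAST \<alpha>. bfs_B V E lt \<alpha> = bfs_B V E lt (ord_succ \<alpha>))"

definition bfs_traversal :: "'v set \<Rightarrow> 'v rel \<Rightarrow> 'v rel \<Rightarrow> 'v rel" where
  "bfs_traversal V E lt =
     {(bfs_q V E lt \<alpha>, bfs_q V E lt \<beta>) | \<alpha> \<beta>. \<alpha> \<le> \<beta> \<and> \<beta> < bfs_closure V E lt}"

lemma bfs_B_mono: "\<alpha> \<le> \<beta> \<Longrightarrow> bfs_B V E lt \<alpha> \<subseteq> bfs_B V E lt \<beta>"
proof (induction \<beta> rule: less_induct)
  case (less \<beta>)
  show ?case
  proof (cases "\<alpha> = \<beta>")
    case False
    then have "\<alpha> < \<beta>"
      using less.prems by simp
    consider \<gamma> where "\<beta> = ord_succ \<gamma>" | "ord_limit \<beta>"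
      using \<open>\<alpha> < \<beta>\<close> ord_limit_def ord_zero_le leD by metis
    then show ?thesis
    proof cases
      case 1
      then have "\<alpha> \<le> \<gamma>"
        using \<open>\<alpha> < \<beta>\<close> ord_succ_le leD not_le by metis
      then have "bfs_B V E lt \<alpha> \<subseteq> bfs_B V E lt \<gamma>"
        using less.IH 1 by simp
      also have "\<dots> \<subseteq> bfs_B V E lt \<beta>"
        unfolding 1 by (auto simp: bfs_B_def bfs_succ bfs_step_def Let_def split: prod.splits)
      finally show ?thesis .
    next
      case 2
      then show ?thesis
        using \<open>\<alpha> < \<beta>\<close> by (auto simp: bfs_B_def bfs_limit)
    qed
  qed simp
qed

lemma bfs_closure_exists: "\<exists>\<alpha>. bfs_B V E lt \<alpha> = bfs_B V E lt (ord_succ \<alpha>)"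
proof (rule ccontr)
  assume *: "\<nexists>\<alpha>. bfs_B V E lt \<alpha> = bfs_B V E lt (ord_succ \<alpha>)"
  have B_succ: "bfs_B V E lt (ord_succ \<alpha>) = insert (bfs_q V E lt \<alpha>) (bfs_B V E lt \<alpha>)" for \<alpha>
    using *[simplified, rule_format, of \<alpha>]
    by (auto simp: bfs_B_def bfs_Q_def bfs_q_def bfs_succ bfs_step_def Let_def
        split: prod.splits if_splits)
  have "bfs_q V E lt \<alpha> \<noteq> bfs_q V E lt \<beta>" if "\<alpha> < \<beta>" for \<alpha> \<beta>
  proof -
    have "bfs_q V E lt \<alpha> \<in> bfs_B V E lt \<beta>"
      using bfs_B_mono[OF ord_succ_le[OF that], of V E lt] B_succ by auto
    moreover have "bfs_q V E lt \<beta> \<notin> bfs_B V E lt \<beta>"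
      using * B_succ[of \<beta>] by (metis insert_absorb)
    ultimately show ?thesis
      by metis
  qed
  then have "inj (bfs_q V E lt)"
    by (metis injI linorder_less_linear)
  then show False
    using ordinal_not_inj by blast
qed

definition least_neighbor :: "'v rel \<Rightarrow> 'v rel \<Rightarrow> 'v \<Rightarrow> 'v" where
  "least_neighbor E prec v = wo_rel.minim prec (E `` {v})"

text \<open>
  The least neighbor function is only meaningful away from the \<open>prec\<close>-least vertex; its domain
  restriction is imposed here.
\<close>

definition star_edges :: "'v set \<Rightarrow> 'v rel \<Rightarrow> ('v \<Rightarrow> 'v) \<Rightarrow> 'v rel" where
  "star_edges V prec p =
     (let T = {(v, p v) | v. v \<in> V \<and> v \<noteq> wo_rel.minim prec V} in T \<union> T\<inverse>)"

end

theory Submission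
  imports Defs
begin

text \<open>
  The two searches run in lockstep: at every ordinal stage they have the same set \<open>B\<close> of visited
  vertices and the same queue \<open>Q\<close>. Stages \<open>0\<close> and limit stages do not look at the edges, so only
  a successor stage, which visits some vertex \<open>q\<close>, has to be examined. There the searches agree as
  soon as \<open>E\<close> and \<open>E\<^sup>\<star>\<close> give \<open>q\<close> the same neighbors outside \<open>Q\<close>.

  That they do rests on one observation. Vertices are visited in the order \<open>\<prec>\<close>, and visiting a
  vertex puts all its neighbors into the queue. Hence a vertex \<open>w\<close> outside the present queue is
  adjacent to no vertex visited so far. If \<open>w\<close> is adjacent to the vertex \<open>q\<close> visited now, then
  \<open>q\<close> is the \<open>\<prec>\<close>-least neighbor of \<open>w\<close>, that is \<open>q = p\<^sup>\<circ>(w)\<close>, and the edge between them belongs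
  to \<open>E\<^sup>\<star>\<close> (\<open>least_neighbor_unqueued\<close>). Conversely \<open>E\<^sup>\<star> \<subseteq> E\<close> (\<open>star_edges_subset\<close>).

  For this \<open>\<prec>\<close> must be a wellordering of all of \<open>V\<close>. The queues are wellorderings, each an initial
  segment of the later ones, so there always is a first unvisited entry (\<open>bfs_invariant\<close>).
  The vertices visited when the search closes contain the root and are closed under \<open>E\<close>, so
  connectedness makes them all of \<open>V\<close> (\<open>bfs_B_closure\<close>). About the search in \<open>(V, E\<^sup>\<star>)\<close>
  the argument uses only its recursion equations; its good behavior follows from the agreement of
  the stages.
\<close>

section \<open>Appending to and taking unions of wellorderings\<close>

lemma append_in_order_init_seg:
  assumes "N \<inter> Field Q = {}"
  shows "(Q, append_in_order lt Q N) \<in> init_seg_of"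
  using assms by (auto simp: init_seg_of_def append_in_order_def Field_def)

lemma Field_append_in_order:
  assumes "well_order_on V lt" and "N \<subseteq> V"
  shows "Field (append_in_order lt Q N) = Field Q \<union> N"
proof -
  have "(x, x) \<in> lt" if "x \<in> V" for x
    using assms(1) that by (auto simp: order_on_defs refl_on_def)
  then show ?thesis
    using assms(2) by (fastforce simp: append_in_order_def Field_def)
qed

lemma Well_order_append_in_order:
  assumes Q: "Well_order Q" and lt: "well_order_on V lt" and N: "N \<subseteq> V" "N \<inter> Field Q = {}"
  shows "Well_order (append_in_order lt Q N)"
proof -
  let ?L = "lt \<inter> N \<times> N" and ?X = "Field Q \<times> N"
  let ?A = "append_in_order lt Q N"
  have F: "Field ?A = Field Q \<union> N"
    using Field_append_in_order[OF lt N(1)] .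
  have A: "?A = Q \<union> ?X \<union> ?L"
    by (simp add: append_in_order_def)
  have Q_Field: "Q \<subseteq> Field Q \<times> Field Q"
    by (auto simp: Field_def)
  have Q': "refl_on (Field Q) Q" "trans Q" "antisym Q" "total_on (Field Q) Q" "wf (Q - Id)"
    using Q by (auto simp: order_on_defs)
  have lt': "refl_on V lt" "trans lt" "antisym lt" "total_on V lt" "wf (lt - Id)"
    using lt by (auto simp: order_on_defs)
  have "refl_on (Field ?A) ?A"
    using Q'(1) lt'(1) N(1) unfolding F unfolding A refl_on_def by blast
  moreover have "?A \<subseteq> Field ?A \<times> Field ?A"
    by (auto simp: Field_def)
  moreover have "trans ?A"
  proof (rule transI)
    fix x y z
    assume "(x, y) \<in> ?A" "(y, z) \<in> ?A"
    then show "(x, z) \<in> ?A"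
      unfolding A using transD[OF Q'(2), of x y z] transD[OF lt'(2), of x y z] Q_Field N(2)
      by blast
  qed
  moreover have "antisym ?A"
  proof (rule antisymI)
    fix x y
    assume "(x, y) \<in> ?A" "(y, x) \<in> ?A"
    then show "x = y"
      unfolding A using antisymD[OF Q'(3), of x y] antisymD[OF lt'(3), of x y] Q_Field N(2)
      by blast
  qed
  moreover have "total_on (Field ?A) ?A"
    using Q'(4) lt'(4) N(1) unfolding F unfolding A total_on_def by blast
  moreover have "wf (?A - Id)"
  proof -
    \<comment> \<open>A pair in \<open>?X\<close> leads into \<open>N\<close>, which \<open>Q\<close> does not meet and \<open>?L\<close> does not leave, so
      \<open>?X\<close> absorbs whatever follows it and at most one step of a descent uses it.\<close>
    have "wf ?X"
      using N(2) unfolding wf_eq_minimal by blast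
    moreover have "wf ((?L - Id) \<union> (Q - Id))"
    proof (rule wf_Un)
      show "wf (?L - Id)"
        by (rule wf_subset[OF lt'(5)]) blast
      show "wf (Q - Id)"
        by (rule Q'(5))
      show "Domain (?L - Id) \<inter> Range (Q - Id) = {}"
        using Q_Field N(2) by blast
    qed
    moreover have "?X O ((?L - Id) \<union> (Q - Id)) \<subseteq> ?X"
      using Q_Field N(2) by blast
    ultimately have "wf (?X \<union> ((?L - Id) \<union> (Q - Id)))"
      by (rule wf_union_compatible)
    then show ?thesis
      by (rule wf_subset) (auto simp: A)
  qed
  ultimately show ?thesis
    by (simp add: order_on_defs)
qed

lemma Well_order_Union_init_seg_chain:
  assumes R: "R \<in> Chains init_seg_of" and wo: "\<And>r. r \<in> R \<Longrightarrow> Well_order r"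
  shows "Well_order (\<Union>R)"
proof -
  have chain: "chain\<^sub>\<subseteq> R"
    using R by (auto simp: init_seg_of_def chain_subset_def Chains_def)
  have r: "\<forall>r\<in>R. Refl r" "\<forall>r\<in>R. trans r" "\<forall>r\<in>R. antisym r" "\<forall>r\<in>R. Total r"
    "\<forall>r\<in>R. wf (r - Id)"
    using wo by (simp_all add: order_on_defs)
  have "\<Union>R \<subseteq> Field (\<Union>R) \<times> Field (\<Union>R)"
    unfolding Field_def by auto
  moreover have "Refl (\<Union>R)"
    using r(1) unfolding refl_on_def by fastforce
  moreover have "wf (\<Union>R - Id)"
  proof -
    have "\<Union>R - Id = \<Union>{r - Id | r. r \<in> R}"
      by blast
    with r(5) wf_Union_wf_init_segs[OF Chains_inits_DiffI[OF R]] show ?thesis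
      by fastforce
  qed
  ultimately show ?thesis
    using chain_subset_trans_Union[OF chain r(2)] chain_subset_antisym_Union[OF chain r(3)]
      chain_subset_Total_Union[OF chain r(4)]
    by (simp add: order_on_defs)
qed

lemma Field_Union_eq: "Field (\<Union>R) = (\<Union>r\<in>R. Field r)"
  by (auto simp: Field_def)

section \<open>Stages of the search\<close>

lemma ordinal_cases [case_names zero succ limit]:
  obtains "\<alpha> = ord_zero" | \<beta> where "\<alpha> = ord_succ \<beta>" | "ord_limit \<alpha>"
  by (auto simp: ord_limit_def)

lemma less_ord_succ_iff: "\<alpha> < ord_succ \<beta> \<longleftrightarrow> \<alpha> \<le> \<beta>"
  by (metis leD le_less_trans less_ord_succ not_le ord_succ_le)

lemma bfs_B_zero: "bfs_B V E lt ord_zero = {}"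
  and bfs_Q_zero: "bfs_Q V E lt ord_zero = {(wo_rel.minim lt V, wo_rel.minim lt V)}"
  by (simp_all add: bfs_B_def bfs_Q_def bfs_zero)

lemma bfs_B_limit: "ord_limit \<alpha> \<Longrightarrow> bfs_B V E lt \<alpha> = (\<Union>\<beta>\<in>{..<\<alpha>}. bfs_B V E lt \<beta>)"
  and bfs_Q_limit: "ord_limit \<alpha> \<Longrightarrow> bfs_Q V E lt \<alpha> = (\<Union>\<beta>\<in>{..<\<alpha>}. bfs_Q V E lt \<beta>)"
  by (simp_all add: bfs_B_def bfs_Q_def bfs_limit)

lemma bfs_B_succ:
    "bfs_B V E lt (ord_succ \<alpha>) =
      (if Field (bfs_Q V E lt \<alpha>) - bfs_B V E lt \<alpha> \<noteq> {}
       then insert (bfs_q V E lt \<alpha>) (bfs_B V E lt \<alpha>) else bfs_B V E lt \<alpha>)"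
  and bfs_Q_succ:
    "bfs_Q V E lt (ord_succ \<alpha>) =
      (if Field (bfs_Q V E lt \<alpha>) - bfs_B V E lt \<alpha> \<noteq> {}
       then append_in_order lt (bfs_Q V E lt \<alpha>)
         (E `` {bfs_q V E lt \<alpha>} - Field (bfs_Q V E lt \<alpha>))
       else bfs_Q V E lt \<alpha>)"
  by (auto simp: bfs_B_def bfs_Q_def bfs_q_def bfs_succ bfs_step_def Let_def split: prod.splits)

lemma bfs_traversal_cong:
  "bfs V E' lt = bfs V E lt \<Longrightarrow> bfs_traversal V E' lt = bfs_traversal V E lt"
  by (simp add: bfs_traversal_def bfs_closure_def bfs_q_def bfs_B_def bfs_Q_def)

locale bfs_graph =
  fixes V :: "'v set" and E lt :: "'v rel"
  assumes graph: "wellordered_connected_graph V E lt" and nonempty: "V \<noteq> {}"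
begin

abbreviation "B \<equiv> bfs_B V E lt"
abbreviation "Q \<equiv> bfs_Q V E lt"
abbreviation "q \<equiv> bfs_q V E lt"
abbreviation "\<Gamma> \<equiv> bfs_closure V E lt"
abbreviation "prec \<equiv> bfs_traversal V E lt"

lemma edges_subset: "E \<subseteq> V \<times> V" and sym_edges: "sym E" and well_order_lt: "well_order_on V lt"
  and connected: "u \<in> V \<Longrightarrow> v \<in> V \<Longrightarrow> (u, v) \<in> E\<^sup>*"
  using graph by (auto simp: wellordered_connected_graph_def)

lemma root_in: "wo_rel.minim lt V \<in> V"
proof -
  have "wo_rel lt" "Field lt = V"
    using well_order_on_Well_order[OF well_order_lt] by (simp_all add: wo_rel_def)
  then show ?thesis
    using wo_rel.minim_in[of lt V] nonempty by simp
qed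

text \<open>
  The wellordering and the end-extension property have to be proved simultaneously: a union of
  wellorderings is a wellordering only because the chain consists of initial segments.
\<close>

lemma bfs_invariant:
  "Well_order (Q \<alpha>) \<and> Field (Q \<alpha>) \<subseteq> V \<and> B \<alpha> \<subseteq> Field (Q \<alpha>) \<and>
   (\<forall>\<beta>\<le>\<alpha>. (Q \<beta>, Q \<alpha>) \<in> init_seg_of)"
proof (induction \<alpha> rule: less_induct)
  case (less \<alpha>)
  show ?case
  proof (cases \<alpha> rule: ordinal_cases)
    case zero
    have "(Q \<beta>, Q \<alpha>) \<in> init_seg_of" if "\<beta> \<le> \<alpha>" for \<beta>
      using that antisym[OF _ ord_zero_le, of \<beta>] by (simp add: zero)
    moreover have "Well_order {(a, a)}" for a :: 'v
      by (auto simp: order_on_defs refl_on_def trans_def antisym_def total_on_def Field_def)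
    ultimately show ?thesis
      using root_in by (simp add: zero bfs_Q_zero bfs_B_zero)
  next
    case (succ \<gamma>)
    have IH: "Well_order (Q \<gamma>)" "Field (Q \<gamma>) \<subseteq> V" "B \<gamma> \<subseteq> Field (Q \<gamma>)"
      "\<And>\<beta>. \<beta> \<le> \<gamma> \<Longrightarrow> (Q \<beta>, Q \<gamma>) \<in> init_seg_of"
      using less.IH[of \<gamma>] by (auto simp: succ)
    have below: "\<beta> = \<alpha> \<or> \<beta> \<le> \<gamma>" if "\<beta> \<le> \<alpha>" for \<beta>
      using that by (auto simp: succ le_less less_ord_succ_iff)
    show ?thesis
    proof (cases "Field (Q \<gamma>) - B \<gamma> = {}")
      case True
      then have "Q \<alpha> = Q \<gamma>" "B \<alpha> = B \<gamma>"
        by (simp_all add: succ bfs_Q_succ bfs_B_succ)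
      with IH below show ?thesis
        by (metis refl_on_init_seg_of)
    next
      case False
      let ?N = "E `` {q \<gamma>} - Field (Q \<gamma>)"
      have Q: "Q \<alpha> = append_in_order lt (Q \<gamma>) ?N" and B: "B \<alpha> = insert (q \<gamma>) (B \<gamma>)"
        using False by (simp_all only: succ bfs_Q_succ bfs_B_succ if_True if_False simp_thms)
      have N: "?N \<subseteq> V" "?N \<inter> Field (Q \<gamma>) = {}"
        using edges_subset by auto
      have F: "Field (Q \<alpha>) = Field (Q \<gamma>) \<union> ?N"
        unfolding Q by (rule Field_append_in_order[OF well_order_lt N(1)])
      have "q \<gamma> \<in> Field (Q \<gamma>)"
        using wo_rel.minim_in[of "Q \<gamma>" "Field (Q \<gamma>) - B \<gamma>"] IH(1) False
        by (auto simp: wo_rel_def bfs_q_def first_unvisited_def)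
      moreover have "Well_order (Q \<alpha>)"
        unfolding Q by (rule Well_order_append_in_order[OF IH(1) well_order_lt N])
      moreover have "(Q \<beta>, Q \<alpha>) \<in> init_seg_of" if "\<beta> \<le> \<alpha>" for \<beta>
        using below[OF that] IH(4) trans_init_seg_of append_in_order_init_seg[OF N(2)]
        unfolding Q by (metis Q refl_on_init_seg_of)
      ultimately show ?thesis
        using IH(2,3) N(1) F B by auto
    qed
  next
    case limit
    let ?R = "Q ` {..<\<alpha>}"
    have Q: "Q \<alpha> = \<Union>?R"
      using limit by (rule bfs_Q_limit)
    have "(Q \<beta>, Q \<gamma>) \<in> init_seg_of \<or> (Q \<gamma>, Q \<beta>) \<in> init_seg_of" if "\<beta> < \<alpha>" "\<gamma> < \<alpha>" for \<beta> \<gamma>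
      using less.IH[OF that(1)] less.IH[OF that(2)] linear[of \<beta> \<gamma>] by blast
    then have chain: "?R \<in> Chains init_seg_of"
      by (auto simp: Chains_def)
    have "Well_order (Q \<alpha>)"
      unfolding Q using less.IH by (intro Well_order_Union_init_seg_chain[OF chain]) auto
    moreover have "Field (Q \<alpha>) = (\<Union>\<beta>\<in>{..<\<alpha>}. Field (Q \<beta>))"
      unfolding Q Field_Union_eq by auto
    moreover have "(Q \<beta>, Q \<alpha>) \<in> init_seg_of" if "\<beta> \<le> \<alpha>" for \<beta>
      using that Chains_init_seg_of_Union[OF chain, of "Q \<beta>"]
      by (cases "\<beta> = \<alpha>") (auto simp flip: Q)
    ultimately show ?thesis
      using less.IH by (fastforce simp: bfs_B_limit[OF limit])
  qed
qed

lemma Field_Q_mono: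
  assumes "\<alpha> \<le> \<beta>"
  shows "Field (Q \<alpha>) \<subseteq> Field (Q \<beta>)"
proof -
  have "(Q \<alpha>, Q \<beta>) \<in> init_seg_of"
    using bfs_invariant[of \<beta>] assms by blast
  then show ?thesis
    by (intro mono_Field) (simp add: init_seg_of_def)
qed

lemma q_in_queue:
  assumes "Field (Q \<alpha>) - B \<alpha> \<noteq> {}"
  shows "q \<alpha> \<in> Field (Q \<alpha>) - B \<alpha>"
proof -
  have "wo_rel (Q \<alpha>)"
    using bfs_invariant[of \<alpha>] by (simp add: wo_rel_def)
  from wo_rel.minim_in[OF this Diff_subset assms] show ?thesis
    unfolding bfs_q_def first_unvisited_def .
qed

lemma neighbors_q_queued:
  assumes "Field (Q \<alpha>) - B \<alpha> \<noteq> {}"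
  shows "E `` {q \<alpha>} \<subseteq> Field (Q (ord_succ \<alpha>))"
proof -
  have "E `` {q \<alpha>} - Field (Q \<alpha>) \<subseteq> V"
    using edges_subset by auto
  from Field_append_in_order[OF well_order_lt this] show ?thesis
    using assms by (auto simp: bfs_Q_succ)
qed

section \<open>The traversal as a wellordering of the vertices\<close>

lemma queue_exhausted_closure: "Field (Q \<Gamma>) = B \<Gamma>"
proof (rule ccontr)
  assume "Field (Q \<Gamma>) \<noteq> B \<Gamma>"
  then have ne: "Field (Q \<Gamma>) - B \<Gamma> \<noteq> {}"
    using bfs_invariant[of \<Gamma>] by auto
  have "B \<Gamma> = B (ord_succ \<Gamma>)"
    unfolding bfs_closure_def using bfs_closure_exists by (rule LeastI_ex)
  also have "\<dots> = insert (q \<Gamma>) (B \<Gamma>)"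
    using ne by (simp only: bfs_B_succ if_True not_False_eq_True)
  finally show False
    using q_in_queue[OF ne] by blast
qed

lemma before_closure:
  assumes "\<alpha> < \<Gamma>"
  shows "Field (Q \<alpha>) - B \<alpha> \<noteq> {}"
proof
  assume "Field (Q \<alpha>) - B \<alpha> = {}"
  then have "B \<alpha> = B (ord_succ \<alpha>)"
    by (simp add: bfs_B_succ)
  with not_less_Least[OF assms[unfolded bfs_closure_def]] show False
    by simp
qed

lemma bfs_B_eq_image: "\<alpha> \<le> \<Gamma> \<Longrightarrow> B \<alpha> = q ` {..<\<alpha>}"
proof (induction \<alpha> rule: less_induct)
  case (less \<alpha>)
  show ?case
  proof (cases \<alpha> rule: ordinal_cases)
    case zero
    moreover have "\<not> x < ord_zero" for x :: "'v ordinal"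
      by (simp add: not_less)
    ultimately show ?thesis
      by (auto simp: bfs_B_zero)
  next
    case (succ \<gamma>)
    then have "\<gamma> < \<Gamma>"
      using less.prems by (auto intro: less_le_trans[OF less_ord_succ])
    then have "B \<alpha> = insert (q \<gamma>) (q ` {..<\<gamma>})"
      using before_closure[of \<gamma>] less.IH[of \<gamma>] by (simp add: succ bfs_B_succ)
    moreover have "{..<\<alpha>} = insert \<gamma> {..<\<gamma>}"
      by (auto simp: succ less_ord_succ_iff)
    ultimately show ?thesis
      by simp
  next
    case limit
    have "ord_succ \<gamma> < \<alpha>" if "\<gamma> < \<alpha>" for \<gamma>
      using ord_succ_le[OF that] limit by (auto simp: ord_limit_def le_less)
    then have "{..<\<alpha>} = (\<Union>\<beta>\<in>{..<\<alpha>}. {..<\<beta>})"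
      by (auto intro: less_trans) (meson lessThan_iff less_ord_succ)
    then have "q ` {..<\<alpha>} = (\<Union>\<beta>\<in>{..<\<alpha>}. q ` {..<\<beta>})"
      by (metis image_UN)
    also have "\<dots> = (\<Union>\<beta>\<in>{..<\<alpha>}. B \<beta>)"
      using less.IH less.prems by (intro SUP_cong) auto
    also have "\<dots> = B \<alpha>"
      by (rule bfs_B_limit[OF limit, symmetric])
    finally show ?thesis ..
  qed
qed

text \<open>
  The vertices visited in the whole search contain the root and, since a visited vertex has its
  neighbors queued and the queue is exhausted, are closed under \<open>E\<close>.
\<close>

lemma bfs_B_closure: "B \<Gamma> = V"
proof
  show "B \<Gamma> \<subseteq> V"
    using bfs_invariant[of \<Gamma>] by blast
  have step: "v \<in> B \<Gamma>" if "u \<in> B \<Gamma>" "(u, v) \<in> E" for u v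
  proof -
    obtain \<alpha> where \<alpha>: "\<alpha> < \<Gamma>" "u = q \<alpha>"
      using \<open>u \<in> B \<Gamma>\<close> bfs_B_eq_image[of \<Gamma>] by auto
    then have "v \<in> Field (Q (ord_succ \<alpha>))"
      using neighbors_q_queued[OF before_closure] that(2) by auto
    then show ?thesis
      using Field_Q_mono[OF ord_succ_le[OF \<alpha>(1)]] queue_exhausted_closure by blast
  qed
  have root: "wo_rel.minim lt V \<in> B \<Gamma>"
    using Field_Q_mono[of ord_zero \<Gamma>] queue_exhausted_closure by (auto simp: bfs_Q_zero Field_def)
  show "V \<subseteq> B \<Gamma>"
  proof
    fix v
    assume "v \<in> V"
    from connected[OF root_in this] show "v \<in> B \<Gamma>"
      by (induction rule: rtrancl_induct) (fact root, erule step)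
  qed
qed

lemma q_image: "q ` {..<\<Gamma>} = V"
  by (rule trans[OF bfs_B_eq_image[OF order_refl, symmetric] bfs_B_closure])

lemma q_inj: "inj_on q {..<\<Gamma>}"
proof (rule linorder_inj_onI')
  fix \<alpha> \<beta>
  assume \<beta>: "\<beta> \<in> {..<\<Gamma>}" and less: "\<alpha> < \<beta>"
  have "q \<beta> \<notin> B \<beta>"
    using q_in_queue[OF before_closure, of \<beta>] \<beta> by simp
  moreover have "q \<alpha> \<in> B \<beta>"
    unfolding bfs_B_eq_image[OF less_imp_le[OF \<beta>[unfolded lessThan_iff]]]
    by (rule imageI) (simp add: less)
  ultimately show "q \<alpha> \<noteq> q \<beta>"
    by metis
qed

lemma prec_iff:
  assumes "\<alpha> < \<Gamma>" "\<beta> < \<Gamma>"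
  shows "(q \<alpha>, q \<beta>) \<in> prec \<longleftrightarrow> \<alpha> \<le> \<beta>"
proof
  assume "(q \<alpha>, q \<beta>) \<in> prec"
  then have "\<exists>\<alpha>' \<beta>'. q \<alpha> = q \<alpha>' \<and> q \<beta> = q \<beta>' \<and> \<alpha>' \<le> \<beta>' \<and> \<beta>' < \<Gamma>"
    by (simp add: bfs_traversal_def)
  then obtain \<alpha>' \<beta>' where *: "q \<alpha> = q \<alpha>'" "q \<beta> = q \<beta>'" "\<alpha>' \<le> \<beta>'" "\<beta>' < \<Gamma>"
    by (elim exE conjE)
  then have "\<alpha> = \<alpha>'" "\<beta> = \<beta>'"
    using assms by (auto intro: inj_onD[OF q_inj])
  with * show "\<alpha> \<le> \<beta>"
    by simp
next
  assume "\<alpha> \<le> \<beta>"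
  with assms(2) show "(q \<alpha>, q \<beta>) \<in> prec"
    unfolding bfs_traversal_def mem_Collect_eq by (intro exI[of _ \<alpha>] exI[of _ \<beta>]) simp
qed

lemma Well_order_prec: "Well_order prec" and Field_prec: "Field prec = V"
proof -
  let ?r = "{(\<alpha>, \<beta>). \<alpha> \<le> \<beta> \<and> \<beta> < \<Gamma>}"
  have r: "Field ?r = {..<\<Gamma>}"
    by (auto simp: Field_def)
  have "wf (?r - Id)"
    by (rule wf_subset[OF wf]) auto
  then have "Well_order ?r"
    unfolding r by (auto simp: order_on_defs refl_on_def trans_def antisym_def total_on_def)
  moreover have prec: "prec = dir_image ?r q"
    by (auto simp: bfs_traversal_def dir_image_def)
  ultimately show "Well_order prec"
    using Well_order_dir_image[of ?r q] q_inj unfolding r by simp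
  show "Field prec = V"
    unfolding prec dir_image_Field r by (rule q_image)
qed

lemma wo_rel_prec: "wo_rel prec"
  using Well_order_prec by (simp add: wo_rel_def)

section \<open>Least neighbors and the search tree\<close>

abbreviation "p \<equiv> least_neighbor E prec"
abbreviation "E_star \<equiv> star_edges V prec p"

lemma has_neighbor:
  assumes "v \<in> V" "v \<noteq> wo_rel.minim prec V"
  shows "E `` {v} \<noteq> {}"
proof -
  have "wo_rel.minim prec V \<in> V"
    using wo_rel.minim_in[OF wo_rel_prec, of V] nonempty Field_prec by simp
  from connected[OF assms(1) this] show ?thesis
    by (cases rule: converse_rtranclE) (use assms(2) in auto)
qed

lemma star_edges_subset: "E_star \<subseteq> E"
proof -
  have "(v, p v) \<in> E" if "v \<in> V" "v \<noteq> wo_rel.minim prec V" for v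
    using wo_rel.minim_in[OF wo_rel_prec, of "E `` {v}"] has_neighbor[OF that] edges_subset
      Field_prec
    by (auto simp: least_neighbor_def)
  then show ?thesis
    using sym_edges by (auto simp: star_edges_def Let_def dest: symD)
qed

text \<open>
  A vertex with an earlier neighbor would have been queued when that neighbor was visited.
\<close>

lemma least_neighbor_unqueued:
  assumes \<alpha>: "\<alpha> < \<Gamma>" and edge: "(q \<alpha>, w) \<in> E" and w: "w \<notin> Field (Q \<alpha>)"
  shows "p w = q \<alpha>"
proof -
  have "(q \<alpha>, u) \<in> prec" if u: "(w, u) \<in> E" for u
  proof -
    have "u \<in> V"
      using u edges_subset by auto
    then obtain \<beta> where \<beta>: "\<beta> < \<Gamma>" "u = q \<beta>"
      using q_image by auto
    have "\<alpha> \<le> \<beta>"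
    proof (rule ccontr)
      assume "\<not> \<alpha> \<le> \<beta>"
      then have "ord_succ \<beta> \<le> \<alpha>"
        by (simp add: ord_succ_le)
      moreover have "w \<in> Field (Q (ord_succ \<beta>))"
        using neighbors_q_queued[OF before_closure[OF \<beta>(1)]] u sym_edges \<beta>(2)
        by (auto dest: symD)
      ultimately show False
        using Field_Q_mono w by blast
    qed
    then show ?thesis
      using prec_iff \<alpha> \<beta> by simp
  qed
  moreover have "(w, q \<alpha>) \<in> E"
    using edge sym_edges by (auto dest: symD)
  moreover have "E `` {w} \<subseteq> Field prec"
    using edges_subset Field_prec by auto
  ultimately have "q \<alpha> = wo_rel.minim prec (E `` {w})"
    by (intro wo_rel.equals_minim[OF wo_rel_prec]) auto
  then show ?thesis
    by (simp add: least_neighbor_def)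
qed

text \<open>
  The minimal vertex contributes no edge to \<open>E\<^sup>\<star>\<close> through its own least neighbor. It is visited no
  later than any other vertex, hence is in every queue.
\<close>

lemma unqueued_not_minimal:
  assumes \<alpha>: "\<alpha> < \<Gamma>" and w: "w \<notin> Field (Q \<alpha>)"
  shows "w \<noteq> wo_rel.minim prec V"
proof
  assume eq: "w = wo_rel.minim prec V"
  have "w \<in> V"
    unfolding eq using wo_rel.minim_in[OF wo_rel_prec, of V] nonempty Field_prec by simp
  then obtain \<beta> where \<beta>: "\<beta> < \<Gamma>" "w = q \<beta>"
    using q_image by auto
  have "(w, q \<alpha>) \<in> prec"
    unfolding eq using wo_rel.minim_least[OF wo_rel_prec, of V] Field_prec q_image \<alpha> by auto
  then have "\<beta> \<le> \<alpha>"
    using prec_iff \<alpha> \<beta> by simp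
  then show False
    using q_in_queue[OF before_closure[OF \<beta>(1)]] Field_Q_mono w \<beta>(2) by blast
qed

lemma star_neighbors_unqueued:
  assumes \<alpha>: "\<alpha> < \<Gamma>"
  shows "E `` {q \<alpha>} - Field (Q \<alpha>) = E_star `` {q \<alpha>} - Field (Q \<alpha>)"
proof
  show "E_star `` {q \<alpha>} - Field (Q \<alpha>) \<subseteq> E `` {q \<alpha>} - Field (Q \<alpha>)"
    using star_edges_subset by auto
  show "E `` {q \<alpha>} - Field (Q \<alpha>) \<subseteq> E_star `` {q \<alpha>} - Field (Q \<alpha>)"
  proof
    fix w
    assume "w \<in> E `` {q \<alpha>} - Field (Q \<alpha>)"
    then have w: "(q \<alpha>, w) \<in> E" "w \<notin> Field (Q \<alpha>)"
      by auto
    then have "w \<in> V" "w \<noteq> wo_rel.minim prec V" "p w = q \<alpha>"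
      using edges_subset unqueued_not_minimal[OF \<alpha>] least_neighbor_unqueued[OF \<alpha>] by auto
    then have "(q \<alpha>, w) \<in> E_star"
      by (auto simp: star_edges_def Let_def)
    with w show "w \<in> E_star `` {q \<alpha>} - Field (Q \<alpha>)"
      by simp
  qed
qed

text \<open>
  At a successor stage the neighborhoods are compared only if the queue has an unvisited entry. By
  then the search has not closed, since all of \<open>V\<close> is visited at the closure ordinal, so the visited
  vertex has a place in \<open>\<prec>\<close> and \<open>star_neighbors_unqueued\<close> applies.
\<close>

lemma bfs_star_eq: "bfs V E_star lt \<alpha> = bfs V E lt \<alpha>"
proof (induction \<alpha> rule: less_induct)
  case (less \<alpha>)
  show ?case
  proof (cases \<alpha> rule: ordinal_cases)
    case zero
    then show ?thesis
      by (simp add: bfs_zero)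
  next
    case (succ \<gamma>)
    then have IH: "bfs V E_star lt \<gamma> = bfs V E lt \<gamma>"
      using less.IH by simp
    have "bfs_step E_star lt (B \<gamma>, Q \<gamma>) = bfs_step E lt (B \<gamma>, Q \<gamma>)"
    proof (cases "Field (Q \<gamma>) - B \<gamma> = {}")
      case True
      then show ?thesis
        by (simp add: bfs_step_def)
    next
      case False
      have "\<gamma> < \<Gamma>"
      proof (rule ccontr)
        assume "\<not> \<gamma> < \<Gamma>"
        then have "V \<subseteq> B \<gamma>"
          using bfs_B_mono[of \<Gamma> \<gamma> V E lt] bfs_B_closure by simp
        with False bfs_invariant[of \<gamma>] show False
          by blast
      qed
      from star_neighbors_unqueued[OF this] show ?thesis
        by (simp add: bfs_step_def Let_def bfs_q_def)
    qed
    then show ?thesis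
      by (simp add: succ bfs_succ IH bfs_B_def bfs_Q_def)
  next
    case limit
    then show ?thesis
      using less.IH by (simp add: bfs_limit)
  qed
qed

end

section \<open>The traversal of the search tree\<close>

theorem lemma5p5:
  fixes V :: "'v set" and E lt prec prec_star E_star :: "'v rel" and p :: "'v \<Rightarrow> 'v"
  assumes "wellordered_connected_graph V E lt"
    and "V \<noteq> {}"
    and "prec = bfs_traversal V E lt"
    and "p = least_neighbor E prec"
    and "E_star = star_edges V prec p"
    and "prec_star = bfs_traversal V E_star lt"
  shows "prec = prec_star"
proof -
  interpret bfs_graph V E lt
    using assms(1,2) by unfold_locales
  show ?thesis
    using bfs_traversal_cong[OF ext, OF bfs_star_eq] unfolding assms(3-6) by (rule sym)
qed

end
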